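(* Let $A$ be an alphabet, $G$ a finitely generated group, and $(X,F)$ a dynamical system. The following are equivalent: (1) $(X,F)\in CA(A,G)$; (2) there exists a continuous action $\phi$ of $G$ over $X$ such that $F$ commutes with $\phi$ (i.e. $F\circ\phi_g=\phi_g\circ F$ for all $g\in G$) and $X$ is discernible on $A$ by $\phi$.
   Context: A dynamical system is a pair $(X,F)$ with $X$ a compact metrizable space and $F:X\to X$ continuous. Two dynamical systems $(X,F)$, $(X',F')$ are conjugate if there is a continuous bijection $\vartheta:X\to X'$ with $\vartheta\circ F=F'\circ\vartheta$. An alphabet is a finite set with at least two elements, given the discrete topology. A (right) action of a group $G$ over a set $X$ is a family $\phi=\{\phi_g\}_{g\in G}$ of maps $\phi_g:X\to X$ with $\phi_{gh}=\phi_h\circ\phi_g$ for all $g,h\in G$ and $\phi_{1_G}=\mathrm{id}_X$; it is continuous if every $\phi_g$ is continuous. $X$ is discernible on $A$ by $\phi$ if there exists a continuous function $\pi:X\to A$ such that for any two distinct $x_1,x_2\in X$ there exists $g\in G$ with $\pi(\phi_g(x_1))\neq\pi(\phi_g(x_2))$. Let $G$ be a finitely generated group. $A^G$ has the product topology. For $c\in A^G$ and $g\in G$, $c^g\in A^G$ is given by $c^g(h)=c(gh)$; the maps $\sigma^G_g:c\mapsto c^g$ form the natural action of $G$ on $A^G$. A subshift of $A^G$ is a closed subset of $A^G$ invariant under all $\sigma^G_g$. For finite $\mathcal{N}\subseteq G$ and $f:A^{\mathcal{N}}\to A$, $F^{A,G}_f:A^G\to A^G$ is defined by $(F^{A,G}_f(c))(g)=f(c^g|_{\mathcal{N}})$.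 A cellular automaton (CA) with alphabet $A$ and tessellation group $G$ is a triple $\mathcal{A}=\langle X,\mathcal{N},f\rangle$ with $X\subseteq A^G$ a subshift (the support), $\mathcal{N}\subseteq G$ finite, and $f:A^{\mathcal{N}}\to A$ such that $F^{A,G}_f(X)\subseteq X$; its global evolution function $F_{\mathcal{A}}$ is the restriction of $F^{A,G}_f$ to $X$, and $(X,F_{\mathcal{A}})$ is its associated dynamical system. $CA(A,G)$ is the class of dynamical systems conjugate to the associated dynamical system of some CA with alphabet $A$ and tessellation group $G$. *)

theory Defs
  imports "HOL-Analysis.Analysis" "HOL-Algebra.Generated_Groups"
begin

definition dynamical_system :: "'x topology \<Rightarrow> ('x \<Rightarrow> 'x) \<Rightarrow> bool" where
  "dynamical_system X F \<longleftrightarrow>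
     compact_space X \<and> metrizable_space X \<and> continuous_map X X F"

definition conjugate ::
  "'x topology \<Rightarrow> ('x \<Rightarrow> 'x) \<Rightarrow> 'y topology \<Rightarrow> ('y \<Rightarrow> 'y) \<Rightarrow> bool" where
  "conjugate X F X' F' \<longleftrightarrow>
     (\<exists>\<theta>. continuous_map X X' \<theta> \<and> bij_betw \<theta> (topspace X) (topspace X') \<and>
          (\<forall>x\<in>topspace X. \<theta> (F x) = F' (\<theta> x)))"

definition alphabet :: "'a set \<Rightarrow> bool" where
  "alphabet A \<longleftrightarrow> finite A \<and> 2 \<le> card A"

definition finitely_generated_group :: "('g, 'm) monoid_scheme \<Rightarrow> bool" where
  "finitely_generated_group G \<longleftrightarrow>
     group G \<and> (\<exists>S. finite S \<and> S \<subseteq> carrier G \<and> generate G S = carrier G)"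

definition continuous_right_action ::
  "('g, 'm) monoid_scheme \<Rightarrow> 'x topology \<Rightarrow> ('g \<Rightarrow> 'x \<Rightarrow> 'x) \<Rightarrow> bool" where
  "continuous_right_action G X \<phi> \<longleftrightarrow>
     (\<forall>g\<in>carrier G. continuous_map X X (\<phi> g)) \<and>
     (\<forall>g\<in>carrier G. \<forall>h\<in>carrier G. \<forall>x\<in>topspace X. \<phi> (g \<otimes>\<^bsub>G\<^esub> h) x = \<phi> h (\<phi> g x)) \<and>
     (\<forall>x\<in>topspace X. \<phi> \<one>\<^bsub>G\<^esub> x = x)"

definition discernible ::
  "'a set \<Rightarrow> ('g, 'm) monoid_scheme \<Rightarrow> 'x topology \<Rightarrow> ('g \<Rightarrow> 'x \<Rightarrow> 'x) \<Rightarrow> bool" where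
  "discernible A G X \<phi> \<longleftrightarrow>
     (\<exists>\<pi>. continuous_map X (discrete_topology A) \<pi> \<and>
          (\<forall>x1\<in>topspace X. \<forall>x2\<in>topspace X.
             x1 \<noteq> x2 \<longrightarrow> (\<exists>g\<in>carrier G. \<pi> (\<phi> g x1) \<noteq> \<pi> (\<phi> g x2))))"

(* Configurations are extensional functions: the topspace is carrier G \<rightarrow>\<^sub>E A. *)
definition full_shift :: "'a set \<Rightarrow> ('g, 'm) monoid_scheme \<Rightarrow> ('g \<Rightarrow> 'a) topology" where
  "full_shift A G = product_topology (\<lambda>_. discrete_topology A) (carrier G)"

definition shift :: "('g, 'm) monoid_scheme \<Rightarrow> 'g \<Rightarrow> ('g \<Rightarrow> 'a) \<Rightarrow> ('g \<Rightarrow> 'a)" where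
  "shift G g c = (\<lambda>h\<in>carrier G. c (g \<otimes>\<^bsub>G\<^esub> h))"

definition subshift :: "'a set \<Rightarrow> ('g, 'm) monoid_scheme \<Rightarrow> ('g \<Rightarrow> 'a) set \<Rightarrow> bool" where
  "subshift A G Y \<longleftrightarrow> closedin (full_shift A G) Y \<and> (\<forall>g\<in>carrier G. shift G g ` Y \<subseteq> Y)"

definition evolution ::
  "('g, 'm) monoid_scheme \<Rightarrow> 'g set \<Rightarrow> (('g \<Rightarrow> 'a) \<Rightarrow> 'a) \<Rightarrow> ('g \<Rightarrow> 'a) \<Rightarrow> ('g \<Rightarrow> 'a)" where
  "evolution G N f c = (\<lambda>g\<in>carrier G. f (restrict (shift G g c) N))"

definition cellular_automaton ::
  "'a set \<Rightarrow> ('g, 'm) monoid_scheme \<Rightarrow> ('g \<Rightarrow> 'a) set \<Rightarrow> 'g set \<Rightarrow> (('g \<Rightarrow> 'a) \<Rightarrow> 'a) \<Rightarrow> bool" where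
  "cellular_automaton A G Y N f \<longleftrightarrow>
     subshift A G Y \<and> finite N \<and> N \<subseteq> carrier G \<and> f \<in> (N \<rightarrow>\<^sub>E A) \<rightarrow> A \<and>
     evolution G N f ` Y \<subseteq> Y"

definition CA :: "'a set \<Rightarrow> ('g, 'm) monoid_scheme \<Rightarrow> ('x topology \<times> ('x \<Rightarrow> 'x)) set" where
  "CA A G = {(X, F). dynamical_system X F \<and>
     (\<exists>Y N f. cellular_automaton A G Y N f \<and>
        conjugate X F (subtopology (full_shift A G) Y) (restrict (evolution G N f) Y))}"

end

theory Submission
  imports Defs
begin

text \<open>
  A subshift is a space with an action on which the single observable that reads the symbol at
  the identity tells any two points apart along their orbits. Action and observable can be moved
  in both directions along a conjugacy, and they determine the symbolic structure completely.

  Given a conjugacy \<open>\<theta>\<close> onto a cellular automaton, pull the shift back along \<open>\<theta>\<close> and observe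
  \<open>\<pi> x = \<theta> x \<one>\<close>. The symbol of \<open>\<theta> x\<close> at \<open>g\<close> is the symbol at \<open>\<one>\<close> of the \<open>g\<close>-shifted
  configuration, so \<open>\<pi>\<close> together with the action recovers all of \<open>\<theta> x\<close>; this is discernibility.
  The pulled back action is continuous because a continuous bijection from a compact
  onto a Hausdorff space is a homeomorphism, and \<open>F\<close> commutes with it because a uniform local rule
  commutes with the shift (\<open>evolution_shift\<close>).

  Conversely, given an action and an observable \<open>\<pi>\<close>, code \<open>x\<close> by its \<open>itinerary\<close>
  \<open>g \<mapsto> \<pi> (\<phi> g x)\<close>. Discernibility makes the coding injective, compactness makes its image
  closed, and the action law turns \<open>\<phi>\<close> into the shift. It remains to find a local rule, that is,
  finitely many \<open>g\<close> whose observations \<open>\<pi> (\<phi> g x)\<close> determine \<open>\<pi> (F x)\<close>. This is a compactness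
  argument on \<open>X \<times> X\<close> (\<open>finitely_many_observables_determine\<close>) and replaces the
  appeal to the Curtis-Hedlund-Lyndon theorem. Since \<open>F\<close> commutes with \<open>\<phi>\<close>, the rule found for
  position \<open>\<one>\<close> is correct at every position.
\<close>

section \<open>Shifts and local rules\<close>

lemma topspace_full_shift: "topspace (full_shift A G) = (carrier G \<rightarrow>\<^sub>E A)"
  by (simp add: full_shift_def)

lemma Hausdorff_space_full_shift: "Hausdorff_space (full_shift A G)"
  by (simp add: full_shift_def Hausdorff_space_product_topology)

lemma continuous_map_full_shift_component:
  assumes "g \<in> carrier G"
  shows "continuous_map (full_shift A G) (discrete_topology A) (\<lambda>c. c g)"
  unfolding full_shift_def by (rule continuous_map_product_projection[OF assms])

lemma subshift_subset_topspace: "subshift A G Y \<Longrightarrow> Y \<subseteq> topspace (full_shift A G)"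
  unfolding subshift_def by (blast dest: closedin_subset)

lemma continuous_map_shift:
  assumes "group G" "g \<in> carrier G"
  shows "continuous_map (full_shift A G) (full_shift A G) (shift G g)"
proof -
  have "continuous_map (full_shift A G) (discrete_topology A) (\<lambda>c. shift G g c h)"
    if "h \<in> carrier G" for h
    using that assms continuous_map_full_shift_component[of "g \<otimes>\<^bsub>G\<^esub> h" G A]
    by (simp add: shift_def group.is_monoid monoid.m_closed)
  then show ?thesis
    by (subst (2) full_shift_def) (auto simp: continuous_map_componentwise shift_def)
qed

lemma shift_mult:
  assumes "group G" "g \<in> carrier G" "h \<in> carrier G"
  shows "shift G (g \<otimes>\<^bsub>G\<^esub> h) c = shift G h (shift G g c)"
proof -
  interpret group G by fact
  show ?thesis
    using assms by (auto simp: shift_def m_assoc fun_eq_iff)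
qed

lemma shift_one:
  assumes "group G" "c \<in> carrier G \<rightarrow>\<^sub>E A"
  shows "shift G \<one>\<^bsub>G\<^esub> c = c"
proof -
  interpret group G by fact
  show ?thesis
    using PiE_restrict[OF assms(2)] by (simp add: shift_def cong: restrict_cong)
qed

lemma shift_apply_one:
  assumes "group G" "g \<in> carrier G"
  shows "shift G g c \<one>\<^bsub>G\<^esub> = c g"
proof -
  interpret group G by fact
  show ?thesis
    using assms(2) by (simp add: shift_def)
qed

lemma evolution_shift:
  assumes "group G" "g \<in> carrier G"
  shows "evolution G N f (shift G g c) = shift G g (evolution G N f c)"
proof -
  interpret group G by fact
  show ?thesis
    using assms(2) unfolding evolution_def shift_def[of G g "restrict _ _"]
    by (intro restrict_ext) (simp add: shift_mult[OF assms(1)])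
qed

section \<open>From an automaton to an action\<close>

text \<open>
  The action is conjugated through \<open>\<theta>\<close>, whose inverse \<open>\<eta>\<close> is continuous by compactness. The
  observable is the symbol at the identity, from which shifting recovers every other symbol.
\<close>

lemma action_of_CA:
  fixes X :: "'x topology"
  assumes G: "group G"
    and CA: "(X, F) \<in> CA A G"
  shows "\<exists>\<phi>. continuous_right_action G X \<phi> \<and>
      (\<forall>g\<in>carrier G. \<forall>x\<in>topspace X. F (\<phi> g x) = \<phi> g (F x)) \<and> discernible A G X \<phi>"
proof -
  interpret group G by fact
  obtain Y N f \<theta> where aut: "cellular_automaton A G Y N f"
    and X: "dynamical_system X F"
    and \<theta>: "continuous_map X (subtopology (full_shift A G) Y) \<theta>"
    and bij: "bij_betw \<theta> (topspace X) (topspace (subtopology (full_shift A G) Y))"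
    and conj: "\<And>x. x \<in> topspace X \<Longrightarrow> \<theta> (F x) = restrict (evolution G N f) Y (\<theta> x)"
    using CA unfolding CA_def conjugate_def by blast
  let ?Y = "subtopology (full_shift A G) Y"
  have sub: "subshift A G Y"
    using aut by (simp add: cellular_automaton_def)
  have topY: "topspace ?Y = Y"
    using subshift_subset_topspace[OF sub] by auto
  have YA: "Y \<subseteq> carrier G \<rightarrow>\<^sub>E A"
    using subshift_subset_topspace[OF sub] by (simp add: topspace_full_shift)
  have shiftY: "shift G g c \<in> Y" if "g \<in> carrier G" "c \<in> Y" for g c
    using sub that by (auto simp: subshift_def)
  have F: "F x \<in> topspace X" if "x \<in> topspace X" for x
    using X that unfolding dynamical_system_def continuous_map_def by blast
  have "homeomorphic_map X ?Y \<theta>"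
    using X \<theta> bij by (intro continuous_imp_homeomorphic_map)
      (auto simp: dynamical_system_def Hausdorff_space_subtopology Hausdorff_space_full_shift
        bij_betw_def)
  then obtain \<eta> where \<eta>: "homeomorphic_maps X ?Y \<theta> \<eta>"
    by (auto simp: homeomorphic_map_maps)
  then have \<eta>_cont: "continuous_map ?Y X \<eta>"
    and \<eta>\<theta>: "\<And>x. x \<in> topspace X \<Longrightarrow> \<eta> (\<theta> x) = x"
    and \<theta>\<eta>: "\<And>c. c \<in> Y \<Longrightarrow> \<theta> (\<eta> c) = c"
    using topY by (auto simp: homeomorphic_maps_def)
  have \<theta>Y: "\<theta> x \<in> Y" if "x \<in> topspace X" for x
    using bij that topY by (auto simp: bij_betw_def)
  have \<eta>X: "\<eta> c \<in> topspace X" if "c \<in> Y" for c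
    using \<eta>_cont that topY by (auto simp: continuous_map_def)
  define \<phi> where "\<phi> g x = \<eta> (shift G g (\<theta> x))" for g x
  have \<theta>\<phi>: "\<theta> (\<phi> g x) = shift G g (\<theta> x)" if "g \<in> carrier G" "x \<in> topspace X" for g x
    using that by (simp add: \<phi>_def \<theta>\<eta> shiftY \<theta>Y)
  have \<phi>X: "\<phi> g x \<in> topspace X" if "g \<in> carrier G" "x \<in> topspace X" for g x
    using that by (simp add: \<phi>_def \<eta>X shiftY \<theta>Y)
  have "continuous_map X X (\<phi> g)" if g: "g \<in> carrier G" for g
  proof -
    have "continuous_map ?Y ?Y (shift G g)"
      using continuous_map_from_subtopology[OF continuous_map_shift[OF G g, of A], of Y]
        shiftY[OF g]
      by (auto simp: continuous_map_in_subtopology)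
    then show ?thesis
      using continuous_map_compose[OF continuous_map_compose[OF \<theta>] \<eta>_cont]
      by (auto simp: \<phi>_def[abs_def] o_def)
  qed
  moreover have "\<phi> (g \<otimes>\<^bsub>G\<^esub> h) x = \<phi> h (\<phi> g x)"
    if "g \<in> carrier G" "h \<in> carrier G" "x \<in> topspace X" for g h x
    using that by (simp add: \<phi>_def[of h] \<phi>_def[of "g \<otimes>\<^bsub>G\<^esub> h"] \<theta>\<phi> shift_mult[OF G])
  moreover have "\<phi> \<one>\<^bsub>G\<^esub> x = x" if "x \<in> topspace X" for x
    using that \<theta>Y YA by (simp add: \<phi>_def \<eta>\<theta> shift_one[OF G, of _ A] subset_iff)
  ultimately have "continuous_right_action G X \<phi>"
    by (simp add: continuous_right_action_def)
  moreover have "F (\<phi> g x) = \<phi> g (F x)" if g: "g \<in> carrier G" and x: "x \<in> topspace X" for g x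
  proof -
    have "\<theta> (F (\<phi> g x)) = shift G g (\<theta> (F x))"
      using g x by (simp add: conj \<phi>X \<theta>\<phi> \<theta>Y shiftY evolution_shift[OF G])
    then have "\<eta> (\<theta> (F (\<phi> g x))) = \<phi> g (F x)"
      by (simp add: \<phi>_def)
    then show ?thesis
      using g x by (simp add: \<eta>\<theta> F \<phi>X)
  qed
  moreover have "discernible A G X \<phi>"
    unfolding discernible_def
  proof (intro exI[of _ "\<lambda>x. \<theta> x \<one>\<^bsub>G\<^esub>"] conjI ballI impI)
    have "continuous_map X (full_shift A G) \<theta>"
      using \<theta> by (simp add: continuous_map_in_subtopology)
    then show "continuous_map X (discrete_topology A) (\<lambda>x. \<theta> x \<one>\<^bsub>G\<^esub>)"
      using continuous_map_compose[OF _ continuous_map_full_shift_component[OF one_closed, of A]]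
      by (auto simp: o_def)
  next
    fix x y assume xy: "x \<in> topspace X" "y \<in> topspace X" "x \<noteq> y"
    then have "\<theta> x \<noteq> \<theta> y"
      using \<eta>\<theta> by metis
    then obtain g where "g \<in> carrier G" "\<theta> x g \<noteq> \<theta> y g"
      using PiE_ext[of "\<theta> x" "carrier G" "\<lambda>_. A" "\<theta> y"] \<theta>Y xy YA by blast
    with xy show "\<exists>g\<in>carrier G. \<theta> (\<phi> g x) \<one>\<^bsub>G\<^esub> \<noteq> \<theta> (\<phi> g y) \<one>\<^bsub>G\<^esub>"
      by (auto simp: \<theta>\<phi> shift_apply_one[OF G])
  qed
  ultimately show ?thesis
    by blast
qed

section \<open>From an action to an automaton\<close>

lemma clopen_observable_differs:
  assumes "continuous_map X (discrete_topology A) p"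
  defines "D \<equiv> {z \<in> topspace X \<times> topspace X. p (fst z) \<noteq> p (snd z)}"
  shows "openin (prod_topology X X) D" "closedin (prod_topology X X) D"
proof -
  let ?h = "\<lambda>z. (p (fst z), p (snd z))"
  let ?V = "{w \<in> A \<times> A. fst w \<noteq> snd w}"
  have "continuous_map (prod_topology X X)
      (prod_topology (discrete_topology A) (discrete_topology A)) ?h"
    using continuous_map_compose[OF continuous_map_fst[of X X] assms(1)]
      continuous_map_compose[OF continuous_map_snd[of X X] assms(1)]
    by (simp add: continuous_map_paired o_def)
  then have h: "continuous_map (prod_topology X X) (discrete_topology (A \<times> A)) ?h"
    by (simp add: prod_topology_discrete_topology)
  have "p x \<in> A" if "x \<in> topspace X" for x
    using assms(1) that by (auto simp: continuous_map_def)
  then have D: "D = {z \<in> topspace (prod_topology X X). ?h z \<in> ?V}"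
    by (auto simp: D_def)
  show "openin (prod_topology X X) D"
    unfolding D by (rule openin_continuous_map_preimage[OF h]) auto
  show "closedin (prod_topology X X) D"
    unfolding D by (rule closedin_continuous_map_preimage[OF h]) auto
qed

text \<open>
  The pairs on which \<open>p\<close> differs form a closed, hence compact, subset of \<open>X \<times> X\<close>. No such pair is
  on the diagonal, so some \<open>q i\<close> separates it, and it separates all nearby pairs as well. A finite
  subcover is a finite set of observables that separates whatever \<open>p\<close> separates.
\<close>

lemma finitely_many_observables_determine:
  assumes X: "compact_space X"
    and q: "\<And>i. i \<in> I \<Longrightarrow> continuous_map X (discrete_topology A) (q i)"
    and sep: "\<And>x y. \<lbrakk>x \<in> topspace X; y \<in> topspace X; x \<noteq> y\<rbrakk> \<Longrightarrow> \<exists>i\<in>I. q i x \<noteq> q i y"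
    and p: "continuous_map X (discrete_topology B) p"
  obtains N where "finite N" "N \<subseteq> I"
    "\<And>x y. \<lbrakk>x \<in> topspace X; y \<in> topspace X; \<And>i. i \<in> N \<Longrightarrow> q i x = q i y\<rbrakk> \<Longrightarrow> p x = p y"
proof -
  let ?differ = "\<lambda>r. {z \<in> topspace X \<times> topspace X. r (fst z) \<noteq> r (snd z)}"
  have "compactin (prod_topology X X) (?differ p)"
    using X clopen_observable_differs(2)[OF p]
    by (intro closedin_compact_space) (auto simp: compact_space_prod_topology)
  moreover have "?differ p \<subseteq> \<Union> ((\<lambda>i. ?differ (q i)) ` I)"
    using sep by fastforce
  ultimately obtain \<U> where "finite \<U>" "\<U> \<subseteq> (\<lambda>i. ?differ (q i)) ` I" "?differ p \<subseteq> \<Union>\<U>"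
    using clopen_observable_differs(1)[OF q] unfolding compactin_def by (metis (no_types, lifting) imageE)
  then obtain N where N: "finite N" "N \<subseteq> I" "?differ p \<subseteq> \<Union> ((\<lambda>i. ?differ (q i)) ` N)"
    by (metis (no_types, lifting) finite_subset_image)
  show thesis
  proof (rule that[OF N(1,2)])
    fix x y assume "x \<in> topspace X" "y \<in> topspace X" "\<And>i. i \<in> N \<Longrightarrow> q i x = q i y"
    then show "p x = p y"
      using subsetD[OF N(3), of "(x, y)"] by auto
  qed
qed

text \<open>
  The right action law is what makes this coding equivariant for the shift \<open>c \<mapsto> c (g \<otimes> _)\<close>:
  \<open>\<phi> (g \<otimes> h) x\<close> is the \<open>h\<close>-translate of \<open>\<phi> g x\<close>.
\<close>

definition itinerary ::
  "('g, 'm) monoid_scheme \<Rightarrow> ('g \<Rightarrow> 'x \<Rightarrow> 'x) \<Rightarrow> ('x \<Rightarrow> 'a) \<Rightarrow> 'x \<Rightarrow> 'g \<Rightarrow> 'a" where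
  "itinerary G \<phi> \<pi> x = (\<lambda>g\<in>carrier G. \<pi> (\<phi> g x))"

lemma continuous_map_itinerary:
  assumes "continuous_right_action G X \<phi>" "continuous_map X (discrete_topology A) \<pi>"
  shows "continuous_map X (full_shift A G) (itinerary G \<phi> \<pi>)"
proof -
  have "continuous_map X (discrete_topology A) (\<lambda>x. \<pi> (\<phi> g x))" if "g \<in> carrier G" for g
    using that assms continuous_map_compose[of X X "\<phi> g" "discrete_topology A" \<pi>]
    by (auto simp: continuous_right_action_def o_def)
  then show ?thesis
    by (auto simp: full_shift_def continuous_map_componentwise itinerary_def)
qed

lemma shift_itinerary:
  assumes "group G" "continuous_right_action G X \<phi>" "g \<in> carrier G" "x \<in> topspace X"
  shows "shift G g (itinerary G \<phi> \<pi> x) = itinerary G \<phi> \<pi> (\<phi> g x)"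
proof -
  interpret group G by fact
  show ?thesis
    using assms(2-) by (auto simp: shift_def itinerary_def continuous_right_action_def fun_eq_iff)
qed

text \<open>
  The local rule only has to be right on patterns that occur in some itinerary; there the symbol
  to be written is unambiguous by \<open>finitely_many_observables_determine\<close>. All other patterns get
  an arbitrary symbol \<open>a\<close>.
\<close>

lemma CA_of_action:
  fixes X :: "'x topology"
  assumes G: "group G"
    and A: "A \<noteq> {}"
    and X: "dynamical_system X F"
    and \<phi>: "continuous_right_action G X \<phi>"
    and comm: "\<And>g x. \<lbrakk>g \<in> carrier G; x \<in> topspace X\<rbrakk> \<Longrightarrow> F (\<phi> g x) = \<phi> g (F x)"
    and disc: "discernible A G X \<phi>"
  shows "(X, F) \<in> CA A G"
proof -
  interpret group G by fact
  obtain \<pi> where \<pi>: "continuous_map X (discrete_topology A) \<pi>"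
    and sep: "\<And>x y. \<lbrakk>x \<in> topspace X; y \<in> topspace X; x \<noteq> y\<rbrakk>
        \<Longrightarrow> \<exists>g\<in>carrier G. \<pi> (\<phi> g x) \<noteq> \<pi> (\<phi> g y)"
    using disc unfolding discernible_def by blast
  obtain a where a: "a \<in> A"
    using A by blast
  have compact: "compact_space X" and F: "continuous_map X X F"
    using X by (auto simp: dynamical_system_def)
  have FX: "F x \<in> topspace X" if "x \<in> topspace X" for x
    using F that by (auto simp: continuous_map_def)
  have \<phi>_cont: "continuous_map X X (\<phi> g)" if "g \<in> carrier G" for g
    using \<phi> that by (auto simp: continuous_right_action_def)
  have \<phi>X: "\<phi> g x \<in> topspace X" if "g \<in> carrier G" "x \<in> topspace X" for g x
    using \<phi>_cont that by (auto simp: continuous_map_def)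
  have \<pi>A: "\<pi> x \<in> A" if "x \<in> topspace X" for x
    using \<pi> that by (auto simp: continuous_map_def)
  let ?\<theta> = "itinerary G \<phi> \<pi>"
  define Y where "Y = ?\<theta> ` topspace X"
  have \<theta>: "continuous_map X (full_shift A G) ?\<theta>"
    by (rule continuous_map_itinerary[OF \<phi> \<pi>])
  have inj: "inj_on ?\<theta> (topspace X)"
  proof (rule inj_onI, rule ccontr)
    fix x y assume xy: "x \<in> topspace X" "y \<in> topspace X" "?\<theta> x = ?\<theta> y" "x \<noteq> y"
    from sep[OF xy(1,2,4)] obtain g where "g \<in> carrier G" "\<pi> (\<phi> g x) \<noteq> \<pi> (\<phi> g y)" ..
    with xy(3) show False
      by (auto simp: itinerary_def dest: fun_cong[of _ _ g])
  qed
  have "compactin (full_shift A G) Y"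
    unfolding Y_def using compact \<theta>
    by (intro image_compactin) (auto simp: compact_space_def)
  then have "closedin (full_shift A G) Y"
    by (rule compactin_imp_closedin[OF Hausdorff_space_full_shift])
  then have sub: "subshift A G Y"
    by (auto simp: subshift_def Y_def shift_itinerary[OF G \<phi>] \<phi>X)
  have topY: "topspace (subtopology (full_shift A G) Y) = Y"
    using subshift_subset_topspace[OF sub] by auto
  have "continuous_map X (discrete_topology A) (\<lambda>x. \<pi> (\<phi> g x))" if "g \<in> carrier G" for g
    using continuous_map_compose[OF \<phi>_cont[OF that] \<pi>] by (simp add: o_def)
  moreover have "continuous_map X (discrete_topology A) (\<lambda>x. \<pi> (F x))"
    using continuous_map_compose[OF F \<pi>] by (simp add: o_def)
  ultimately obtain N where N: "finite N" "N \<subseteq> carrier G"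
    and det: "\<And>x y. \<lbrakk>x \<in> topspace X; y \<in> topspace X;
        \<And>g. g \<in> N \<Longrightarrow> \<pi> (\<phi> g x) = \<pi> (\<phi> g y)\<rbrakk> \<Longrightarrow> \<pi> (F x) = \<pi> (F y)"
    using finitely_many_observables_determine[OF compact, of "carrier G" A "\<lambda>g x. \<pi> (\<phi> g x)" A
        "\<lambda>x. \<pi> (F x)"] sep by metis
  define occurs where "occurs u x \<longleftrightarrow> x \<in> topspace X \<and> restrict (?\<theta> x) N = u" for u x
  define f where "f u = (if \<exists>x. occurs u x then \<pi> (F (SOME x. occurs u x)) else a)" for u
  have f_pattern: "f (restrict (?\<theta> x) N) = \<pi> (F x)" if x: "x \<in> topspace X" for x
  proof -
    let ?u = "restrict (?\<theta> x) N"
    let ?y = "SOME y. occurs ?u y"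
    have ex: "\<exists>y. occurs ?u y"
      using x by (auto simp: occurs_def)
    then have y: "?y \<in> topspace X" "restrict (?\<theta> ?y) N = ?u"
      using someI_ex[OF ex] by (auto simp: occurs_def)
    have "\<pi> (\<phi> g ?y) = \<pi> (\<phi> g x)" if "g \<in> N" for g
      using fun_cong[OF y(2), of g] that N(2) by (auto simp: itinerary_def)
    then have "\<pi> (F ?y) = \<pi> (F x)"
      using y(1) x by (rule det[rotated 2])
    with ex show ?thesis
      by (simp add: f_def)
  qed
  have f_A: "f \<in> (N \<rightarrow>\<^sub>E A) \<rightarrow> A"
  proof
    fix u show "f u \<in> A"
      using someI_ex[of "occurs u"] by (auto simp: f_def a occurs_def[of u] intro!: \<pi>A FX)
  qed
  have step: "evolution G N f (?\<theta> x) = ?\<theta> (F x)" if "x \<in> topspace X" for x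
    using that unfolding itinerary_def[of G \<phi> \<pi> "F x"] evolution_def
    by (intro restrict_ext) (simp add: shift_itinerary[OF G \<phi>] f_pattern \<phi>X comm)
  then have "cellular_automaton A G Y N f"
    using sub N f_A FX by (auto simp: cellular_automaton_def Y_def)
  moreover have "conjugate X F (subtopology (full_shift A G) Y) (restrict (evolution G N f) Y)"
    unfolding conjugate_def topY
    using \<theta> inj step
    by (intro exI[of _ ?\<theta>]) (auto simp: continuous_map_in_subtopology bij_betw_def Y_def)
  ultimately show ?thesis
    using X unfolding CA_def by blast
qed

theorem theorem1:
  fixes A :: "'a set"
    and G :: "('g, 'm) monoid_scheme"
    and X :: "'x topology"
    and F :: "'x \<Rightarrow> 'x"
  assumes "alphabet A"
    and "finitely_generated_group G"
    and "dynamical_system X F"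
  shows "(X, F) \<in> CA A G \<longleftrightarrow>
    (\<exists>\<phi>. continuous_right_action G X \<phi> \<and>
         (\<forall>g\<in>carrier G. \<forall>x\<in>topspace X. F (\<phi> g x) = \<phi> g (F x)) \<and>
         discernible A G X \<phi>)"
proof -
  have "group G" "A \<noteq> {}"
    using assms(1,2) by (auto simp: finitely_generated_group_def alphabet_def)
  then show ?thesis
    using action_of_CA[of G X F A] CA_of_action[of G A X F] assms(3) by blast
qed

end
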